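(* Let $E$ be a Banach space. Then the following hold. (1) If $V, U \subset E$ are closed linear subspaces such that $V$ is finite-dimensional and $E = V \oplus U$, then $E^\ast = V^0 \oplus U^0$, $\dim(U^0) = \dim(V)$, $(V^0)_0 = V$ and $(U^0)_0 = U$. (2) If $F, G \subset E^\ast$ are weak-star closed linear subspaces such that $F$ is finite-dimensional and $E^\ast = F \oplus G$, then $E = F_0 \oplus G_0$, $\dim(G_0) = \dim(F)$, $(F_0)^0 = F$ and $(G_0)^0 = G$. (3) If $V, U \subset E$ are closed linear subspaces such that $V$ is finite-dimensional and $E = V \oplus U$, then $\lVert P_V^U \rVert = \lVert P_{U^0}^{V^0} \rVert$.
   Context: Banach spaces are over the real numbers, and $E^\ast$ denotes the continuous dual of $E$ with the dual norm. For a linear subspace $V \subset E$, the annihilator is $V^0 = \{\ell \in E^\ast : \ell(v) = 0 \text{ for all } v \in V\} \subset E^\ast$. For a linear subspace $F \subset E^\ast$, the pre-annihilator is $F_0 = \{x \in E : \ell(x) = 0 \text{ for all } \ell \in F\} \subset E$. The weak-star topology on $E^\ast$ is the topology $\sigma(E^\ast, E)$. The notation $E = V \oplus U$ means that $V + U = E$ and $V \cap U = \{0\}$ (internal direct sum). If a Banach space is an internal direct sum $A \oplus B$ of two closed linear subspaces, $P_A^B$ denotes the linear projection onto $A$ along $B$, that is, $P_A^B(a + b) = a$ for $a \in A$, $b \in B$; $\lVert \cdot \rVert$ is the operator norm. In (3), $P_{U^0}^{V^0}$ is the projection of $E^\ast$ onto $U^0$ along $V^0$, with respect to the decomposition $E^\ast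 = V^0 \oplus U^0$ from (1). *)

theory Defs
  imports "HOL-Analysis.Analysis"
begin

text \<open>The continuous dual of \<open>'a\<close> is the type \<open>'a \<Rightarrow>\<^sub>L real\<close>, whose norm is the dual norm.\<close>

definition annihilator :: "'a::real_normed_vector set \<Rightarrow> ('a \<Rightarrow>\<^sub>L real) set" where
  "annihilator V = {l. \<forall>v\<in>V. blinfun_apply l v = 0}"

definition preannihilator :: "('a::real_normed_vector \<Rightarrow>\<^sub>L real) set \<Rightarrow> 'a set" where
  "preannihilator F = {x. \<forall>l\<in>F. blinfun_apply l x = 0}"

text \<open>\<open>\<sigma>(E\<^sup>*, E)\<close>: the coarsest topology on the dual that makes every evaluation
  \<open>l \<mapsto> l x\<close> continuous.\<close>

definition weak_star_topology :: "('a::real_normed_vector \<Rightarrow>\<^sub>L real) topology" where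
  "weak_star_topology =
     topology_generated_by {(\<lambda>l. blinfun_apply l x) -` S | x S. open S}"

text \<open>Needed next to \<^const>\<open>dim\<close>, which is 0 on infinite-dimensional subspaces.\<close>

definition finite_dimensional :: "'a::real_vector set \<Rightarrow> bool" where
  "finite_dimensional V \<longleftrightarrow> (\<exists>B. finite B \<and> span B = V)"

definition is_direct_sum :: "'a::real_vector set \<Rightarrow> 'a set \<Rightarrow> bool" where
  "is_direct_sum A B \<longleftrightarrow> {a + b | a b. a \<in> A \<and> b \<in> B} = UNIV \<and> A \<inter> B = {0}"

text \<open>The projection onto \<open>A\<close> along \<open>B\<close>; meaningful when \<open>A\<close> and \<open>B\<close> are subspaces
  with \<open>is_direct_sum A B\<close>.\<close>

definition projection_along :: "'a::real_vector set \<Rightarrow> 'a set \<Rightarrow> 'a \<Rightarrow> 'a" where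
  "projection_along A B x = (THE a. a \<in> A \<and> (\<exists>b\<in>B. x = a + b))"

end

theory Submission
  imports Defs
begin

text \<open>Everything rests on two duality principles. The Hahn--Banach theorem, in the form that the
  distance of a point to a subspace \<open>W\<close> is the value at this point of a functional of norm at most
  1 vanishing on \<open>W\<close>, recovers closed subspaces from their annihilators, yields a biorthogonal system for \<open>V\<close> modulo
  \<open>U\<close>, and provides norming functionals. The purely algebraic fact that a functional vanishing on
  the common kernel of finitely many others is a linear combination of them recovers weak-star
  closed subspaces, because a basic weak-star neighbourhood involves only finitely many
  evaluations. Finally, the projection of the dual is composition with the projection of the
  space.\<close>

section \<open>The Hahn--Banach theorem\<close>

definition sublinear :: "('a::real_vector \<Rightarrow> real) \<Rightarrow> bool" where
  "sublinear p \<longleftrightarrow> (\<forall>x y. p (x + y) \<le> p x + p y) \<and> (\<forall>c\<ge>0. \<forall>x. p (c *\<^sub>R x) = c * p x)"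

text \<open>One inequality for \<open>c > 0\<close> suffices: applied to \<open>inverse c\<close>
  and \<open>c *\<^sub>R x\<close> it yields the reverse one.\<close>

lemma sublinearI:
  assumes add: "\<And>x y. p (x + y) \<le> p x + p y"
    and scale: "\<And>c x. c > 0 \<Longrightarrow> p (c *\<^sub>R x) \<le> c * p x"
    and zero: "p 0 = 0"
  shows "sublinear p"
  unfolding sublinear_def
proof (intro conjI allI impI)
  fix c :: real and x
  assume "c \<ge> 0"
  show "p (c *\<^sub>R x) = c * p x"
  proof (cases "c = 0")
    case False
    with \<open>c \<ge> 0\<close> have "c > 0" by simp
    then have "p (inverse c *\<^sub>R (c *\<^sub>R x)) \<le> inverse c * p (c *\<^sub>R x)"
      by (intro scale) simp
    with \<open>c > 0\<close> have "c * p x \<le> p (c *\<^sub>R x)"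
      by (simp add: field_simps)
    with scale[OF \<open>c > 0\<close>, of x] show ?thesis by simp
  qed (simp add: zero)
qed (rule add)

lemma sublinear_add: "sublinear p \<Longrightarrow> p (x + y) \<le> p x + p y"
  by (simp add: sublinear_def)

lemma sublinear_scale: "sublinear p \<Longrightarrow> c \<ge> 0 \<Longrightarrow> p (c *\<^sub>R x) = c * p x"
  by (simp add: sublinear_def)

lemma sublinear_zero: "sublinear p \<Longrightarrow> p 0 = 0"
  using sublinear_scale[of p 0 0] by simp

lemma sublinear_minus: "sublinear p \<Longrightarrow> - p (- x) \<le> p x"
  using sublinear_add[of p x "- x"] sublinear_zero[of p] by simp

text \<open>The distance to \<open>W\<close> is the quotient seminorm modulo \<open>W\<close>. Since
  \<open>W\<close> is stable under scaling and sums, approximating points of \<open>W\<close> can be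
  scaled and added along with \<open>x\<close> and \<open>y\<close>.\<close>

lemma sublinear_infdist:
  fixes W :: "'a::real_normed_vector set"
  assumes W: "subspace W"
  shows "sublinear (\<lambda>x. infdist x W)"
proof (rule sublinearI)
  have ne: "W \<noteq> {}" using subspace_0[OF W] by auto
  show "infdist 0 W = 0" using subspace_0[OF W] by simp
  show "infdist (c *\<^sub>R x) W \<le> c * infdist x W" if "c > 0" for c x
  proof -
    have "infdist (c *\<^sub>R x) W / c \<le> dist x w" if "w \<in> W" for w
    proof -
      have "infdist (c *\<^sub>R x) W \<le> dist (c *\<^sub>R x) (c *\<^sub>R w)"
        by (intro infdist_le subspace_scale W that)
      also have "\<dots> = c * dist x w"
        using \<open>c > 0\<close> by (simp add: dist_norm flip: scaleR_diff_right)
      finally show ?thesis using \<open>c > 0\<close> by (simp add: field_simps)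
    qed
    then have "infdist (c *\<^sub>R x) W / c \<le> infdist x W"
      unfolding infdist_notempty[OF ne, of x] by (intro cINF_greatest ne)
    then show ?thesis using \<open>c > 0\<close> by (simp add: field_simps)
  qed
  show "infdist (x + y) W \<le> infdist x W + infdist y W" for x y
  proof -
    have *: "infdist (x + y) W \<le> dist x v + dist y w" if "v \<in> W" "w \<in> W" for v w
      using infdist_le[OF subspace_add[OF W that], of "x + y"] dist_triangle_add[of x y v w]
      by linarith
    \<comment> \<open>The two infima are taken one after the other, first over \<open>w\<close> with
      \<open>v\<close> fixed, then over \<open>v\<close>.\<close>
    have "infdist (x + y) W - dist x v \<le> infdist y W" if "v \<in> W" for v
      unfolding infdist_notempty[OF ne, of y] using *[OF that]
      by (intro cINF_greatest ne) (simp add: algebra_simps)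
    then have "infdist (x + y) W - infdist y W \<le> infdist x W"
      unfolding infdist_notempty[OF ne, of x]
      by (intro cINF_greatest ne) (simp add: algebra_simps)
    then show ?thesis by simp
  qed
qed

text \<open>The largest sublinear minorant \<open>q\<close> of \<open>p\<close> with \<open>q (- u) \<le> - p u\<close>.\<close>

definition sublinear_tilt :: "('a::real_vector \<Rightarrow> real) \<Rightarrow> 'a \<Rightarrow> 'a \<Rightarrow> real" where
  "sublinear_tilt p u x = (INF t\<in>{0..}. p (x + t *\<^sub>R u) - t * p u)"

context
  fixes p :: "'a::real_vector \<Rightarrow> real"
  assumes p: "sublinear p"
begin

text \<open>The bound does not depend on \<open>t\<close>, so the infimum defining the tilt is over
  a set bounded below.\<close>

lemma sublinear_tilt_lower:
  assumes "t \<ge> 0"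
  shows "- p (- x) \<le> p (x + t *\<^sub>R u) - t * p u"
  using sublinear_add[OF p, of "- x" "x + t *\<^sub>R u"] sublinear_scale[OF p assms, of u] by simp

lemma sublinear_tilt_le:
  assumes "t \<ge> 0"
  shows "sublinear_tilt p u x \<le> p (x + t *\<^sub>R u) - t * p u"
  unfolding sublinear_tilt_def
proof (rule cINF_lower)
  show "bdd_below ((\<lambda>t. p (x + t *\<^sub>R u) - t * p u) ` {0..})"
    using sublinear_tilt_lower by (intro bdd_belowI2[of _ "- p (- x)"]) simp
qed (use assms in simp)

lemma sublinear_tilt_greatest:
  assumes "\<And>t. t \<ge> 0 \<Longrightarrow> c \<le> p (x + t *\<^sub>R u) - t * p u"
  shows "c \<le> sublinear_tilt p u x"
  unfolding sublinear_tilt_def using assms by (intro cINF_greatest) auto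

lemma sublinear_tilt_le_self: "sublinear_tilt p u x \<le> p x"
  using sublinear_tilt_le[of 0 u x] by simp

lemma sublinear_tilt_minus: "sublinear_tilt p u (- u) \<le> - p u"
  using sublinear_tilt_le[of 1 u "- u"] sublinear_zero[OF p] by simp

text \<open>Reparametrising the infimum does the work: the parameter \<open>t\<close> for
  \<open>x\<close> becomes \<open>c * t\<close> for \<open>c *\<^sub>R x\<close>, and parameters
  \<open>s\<close> for \<open>x\<close> and \<open>t\<close> for \<open>y\<close> combine to
  \<open>s + t\<close> for \<open>x + y\<close>.\<close>

lemma sublinear_sublinear_tilt: "sublinear (sublinear_tilt p u)"
proof (rule sublinearI)
  have "0 \<le> sublinear_tilt p u 0"
    using sublinear_tilt_lower[of _ 0 u] sublinear_zero[OF p]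
    by (intro sublinear_tilt_greatest) simp
  then show "sublinear_tilt p u 0 = 0"
    using sublinear_tilt_le_self[of u 0] sublinear_zero[OF p] by simp
next
  fix c :: real and x
  assume c: "c > 0"
  have "sublinear_tilt p u (c *\<^sub>R x) / c \<le> p (x + t *\<^sub>R u) - t * p u" if "t \<ge> 0" for t
  proof -
    have "sublinear_tilt p u (c *\<^sub>R x) \<le> p (c *\<^sub>R x + (c * t) *\<^sub>R u) - c * t * p u"
      using c that by (intro sublinear_tilt_le) simp
    also have "c *\<^sub>R x + (c * t) *\<^sub>R u = c *\<^sub>R (x + t *\<^sub>R u)"
      by (simp add: scaleR_add_right)
    also have "p \<dots> = c * p (x + t *\<^sub>R u)"
      using c by (intro sublinear_scale p) simp
    finally show ?thesis using c by (simp add: field_simps)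
  qed
  then have "sublinear_tilt p u (c *\<^sub>R x) / c \<le> sublinear_tilt p u x"
    by (rule sublinear_tilt_greatest)
  then show "sublinear_tilt p u (c *\<^sub>R x) \<le> c * sublinear_tilt p u x"
    using c by (simp add: field_simps)
next
  fix x y
  have *: "sublinear_tilt p u (x + y) \<le> (p (x + s *\<^sub>R u) - s * p u) + (p (y + t *\<^sub>R u) - t * p u)"
    if "s \<ge> 0" "t \<ge> 0" for s t
  proof -
    have "sublinear_tilt p u (x + y) \<le> p (x + y + (s + t) *\<^sub>R u) - (s + t) * p u"
      using that by (intro sublinear_tilt_le) simp
    also have "x + y + (s + t) *\<^sub>R u = (x + s *\<^sub>R u) + (y + t *\<^sub>R u)"
      by (simp add: algebra_simps)
    finally show ?thesis
      using sublinear_add[OF p, of "x + s *\<^sub>R u" "y + t *\<^sub>R u"] by (simp add: algebra_simps)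
  qed
  have "sublinear_tilt p u (x + y) - (p (x + s *\<^sub>R u) - s * p u) \<le> sublinear_tilt p u y"
    if "s \<ge> 0" for s
    using *[OF that] by (intro sublinear_tilt_greatest) (simp add: algebra_simps)
  then have "sublinear_tilt p u (x + y) - sublinear_tilt p u y \<le> sublinear_tilt p u x"
    by (intro sublinear_tilt_greatest) (simp add: algebra_simps)
  then show "sublinear_tilt p u (x + y) \<le> sublinear_tilt p u x + sublinear_tilt p u y"
    by simp
qed

text \<open>Minimality forces \<open>p\<close> to coincide with all its tilts. The parameter
  \<open>t = 1\<close> then gives superadditivity, hence additivity, and oddness extends homogeneity
  to negative scalars.\<close>

lemma minimal_sublinear_imp_linear:
  assumes minimal: "\<And>q. sublinear q \<Longrightarrow> q \<le> p \<Longrightarrow> q = p"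
  shows "linear p"
proof -
  have "sublinear_tilt p u = p" for u
    using sublinear_tilt_le_self by (intro minimal sublinear_sublinear_tilt) (simp add: le_fun_def)
  then have "p x \<le> p (x + u) - p u" for x u
    using sublinear_tilt_le[of 1 u x] by simp
  then have add: "p (x + u) = p x + p u" for x u
    using sublinear_add[OF p, of x u] by (smt (verit))
  have minus: "p (- x) = - p x" for x
    using add[of x "- x"] sublinear_zero[OF p] by simp
  show ?thesis
  proof (rule linearI)
    show "p (c *\<^sub>R x) = c *\<^sub>R p x" for c x
      using sublinear_scale[OF p, of c x] sublinear_scale[OF p, of "- c" x] minus[of "c *\<^sub>R x"]
      by (cases "c \<ge> 0") auto
  qed (rule add)
qed

text \<open>Zorn's lemma for the reversed pointwise order: a nonempty chain is bounded by its
  pointwise infimum, which is finite because every member \<open>q\<close> satisfies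
  \<open>- p (- x) \<le> q x\<close>.\<close>

lemma exists_minimal_sublinear:
  "\<exists>m. sublinear m \<and> m \<le> p \<and> (\<forall>q. sublinear q \<longrightarrow> q \<le> m \<longrightarrow> q = m)"
proof -
  define A where "A = {q. sublinear q \<and> q \<le> p}"
  have "\<exists>m\<in>A. \<forall>q\<in>A. m \<ge> q \<longrightarrow> q = m"
  proof (rule predicate_Zorn)
    show "partial_order_on A (relation_of (\<ge>) A)"
      by (auto simp: partial_order_on_def preorder_on_def refl_on_def trans_def antisym_def
          relation_of_def)
    fix C assume "C \<in> Chains (relation_of (\<ge>) A)"
    then have C: "C \<subseteq> A" and chain: "\<And>q r. q \<in> C \<Longrightarrow> r \<in> C \<Longrightarrow> q \<le> r \<or> r \<le> q"
      by (auto simp: Chains_def relation_of_def)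
    show "\<exists>m\<in>A. \<forall>q\<in>C. q \<ge> m"
    proof (cases "C = {}")
      case True
      then show ?thesis using p by (auto simp: A_def)
    next
      case ne: False
      have sub: "sublinear q" and le: "q x \<le> p x" if "q \<in> C" for q x
        using C that by (auto simp: A_def le_fun_def)
      define m where "m x = (INF q\<in>C. q x)" for x
      have bdd: "bdd_below ((\<lambda>q. q x) ` C)" for x
      proof (rule bdd_belowI2[of _ "- p (- x)"])
        show "- p (- x) \<le> q x" if "q \<in> C" for q
          using sublinear_minus[OF sub[OF that], of x] le[OF that, of "- x"] by simp
      qed
      have lower: "m x \<le> q x" if "q \<in> C" for q x
        unfolding m_def by (intro cINF_lower bdd that)
      have greatest: "c \<le> m x" if "\<And>q. q \<in> C \<Longrightarrow> c \<le> q x" for c x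
        unfolding m_def by (intro cINF_greatest ne that)
      have "sublinear m"
      proof (rule sublinearI)
        show "m 0 = 0"
          using ne by (simp add: m_def sublinear_zero[OF sub] cong: INF_cong)
        show "m (c *\<^sub>R x) \<le> c * m x" if "c > 0" for c x
        proof -
          have "m (c *\<^sub>R x) / c \<le> q x" if "q \<in> C" for q
            using lower[OF that, of "c *\<^sub>R x"] sublinear_scale[OF sub[OF that], of c x] \<open>c > 0\<close>
            by (simp add: field_simps)
          then have "m (c *\<^sub>R x) / c \<le> m x" by (rule greatest)
          then show ?thesis using \<open>c > 0\<close> by (simp add: field_simps)
        qed
        show "m (x + y) \<le> m x + m y" for x y
        proof -
          have *: "m (x + y) \<le> q x + r y" if "q \<in> C" "r \<in> C" for q r
          proof -
            \<comment> \<open>In a chain the smaller of \<open>q\<close> and \<open>r\<close> serves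
              at both points \<open>x\<close> and \<open>y\<close>; this is what makes the infimum
              subadditive.\<close>
            from that obtain s where "s \<in> C" "s x \<le> q x" "s y \<le> r y"
              using chain[of q r] \<open>q \<in> C\<close> \<open>r \<in> C\<close> by (metis le_funD order_refl)
            then show ?thesis
              using lower[of s "x + y"] sublinear_add[OF sub, of s x y] by linarith
          qed
          have "m (x + y) - q x \<le> m y" if "q \<in> C" for q
            using *[OF that] by (intro greatest) (simp add: algebra_simps)
          then have "m (x + y) - m y \<le> m x"
            by (intro greatest) (simp add: algebra_simps)
          then show ?thesis by simp
        qed
      qed
      moreover obtain q where "q \<in> C" using ne by auto
      then have "m \<le> p"
        using lower le by (meson le_funI order_trans)
      ultimately show ?thesis
        using lower by (auto simp: A_def le_fun_def)
    qed
  qed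
  then show ?thesis by (auto simp: A_def intro: order_trans)
qed

end

text \<open>A minimal sublinear minorant of the tilt is linear. The tilt bounds
  \<open>f (- u)\<close> by \<open>- p u\<close>, so linearity gives \<open>f u \<ge> p u\<close>,
  the inequality that domination by \<open>p\<close> alone does not provide.\<close>

lemma Hahn_Banach_sublinear:
  assumes p: "sublinear p"
  obtains f where "linear f" "\<And>x. f x \<le> p x" "f u = p u"
proof -
  obtain f where f: "sublinear f" "f \<le> sublinear_tilt p u"
    and minimal: "\<And>q. sublinear q \<Longrightarrow> q \<le> f \<Longrightarrow> q = f"
    using exists_minimal_sublinear[OF sublinear_sublinear_tilt[OF p]] by metis
  have lin: "linear f"
    by (rule minimal_sublinear_imp_linear[OF f(1) minimal])
  have le: "f x \<le> p x" for x
    using f(2) sublinear_tilt_le_self[OF p, of u x] by (meson le_funD order_trans)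
  have "f (- u) \<le> - p u"
    using f(2) sublinear_tilt_minus[OF p, of u] by (meson le_funD order_trans)
  then have "f u = p u"
    using le[of u] by (simp add: linear_neg[OF lin])
  with lin le show ?thesis by (rule that)
qed

text \<open>Domination by the distance to \<open>W\<close> yields everything at once: it is zero on
  \<open>W\<close>, which with both signs forces \<open>f\<close> to vanish there, and it is at most
  the norm because \<open>0\<close> lies in \<open>W\<close>.\<close>

theorem Hahn_Banach_subspace:
  fixes W :: "'a::real_normed_vector set"
  assumes W: "subspace W"
  obtains l :: "'a \<Rightarrow>\<^sub>L real" where "l \<in> annihilator W" "norm l \<le> 1" "blinfun_apply l x = infdist x W"
proof -
  obtain f where f: "linear f" "\<And>y. f y \<le> infdist y W" "f x = infdist x W"
    using Hahn_Banach_sublinear[OF sublinear_infdist[OF W]] by metis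
  have zero: "f w = 0" if "w \<in> W" for w
    using f(2)[of w] f(2)[of "- w"] that subspace_neg[OF W that] by (simp add: linear_neg[OF f(1)])
  have le: "f y \<le> norm y" for y
    using f(2)[of y] infdist_le[OF subspace_0[OF W], of y] by simp
  have norm: "\<bar>f y\<bar> \<le> norm y" for y
    using le[of y] le[of "- y"] by (simp add: linear_neg[OF f(1)])
  have bl: "bounded_linear f"
    using norm linear_add[OF f(1)] linear_scale[OF f(1)]
    by (intro bounded_linear_intro[where K = 1]) simp_all
  show ?thesis
  proof
    show "Blinfun f \<in> annihilator W"
      using zero by (simp add: annihilator_def bounded_linear_Blinfun_apply[OF bl])
    show "norm (Blinfun f) \<le> 1"
      using norm by (intro norm_blinfun_bound) (simp_all add: bounded_linear_Blinfun_apply[OF bl])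
    show "blinfun_apply (Blinfun f) x = infdist x W"
      by (simp add: bounded_linear_Blinfun_apply[OF bl] f)
  qed
qed

section \<open>Finite systems of functionals\<close>

text \<open>Induction on \<open>I\<close>. The relative subspace \<open>S\<close> lets the
  hypothesis for \<open>I\<close> be applied on the part of \<open>S\<close> where
  \<open>f j\<close> vanishes.\<close>

lemma linear_functional_in_span:
  fixes \<phi> :: "'a::real_vector \<Rightarrow> real" and f :: "'i \<Rightarrow> 'a \<Rightarrow> real"
  assumes "finite I" "subspace S" "linear \<phi>" "\<And>i. i \<in> I \<Longrightarrow> linear (f i)"
    and "\<And>x. x \<in> S \<Longrightarrow> (\<And>i. i \<in> I \<Longrightarrow> f i x = 0) \<Longrightarrow> \<phi> x = 0"
  shows "\<exists>c. \<forall>x\<in>S. \<phi> x = (\<Sum>i\<in>I. c i * f i x)"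
  using assms
proof (induction I arbitrary: S rule: finite_induct)
  case empty
  then show ?case by simp
next
  case (insert j I)
  have f: "linear (f j)" using insert.prems by simp
  have "subspace (S \<inter> {x. f j x = 0})"
    using insert.prems linear_subspace_kernel[OF f] by (intro subspace_inter) auto
  then have "\<exists>c. \<forall>x\<in>S \<inter> {x. f j x = 0}. \<phi> x = (\<Sum>i\<in>I. c i * f i x)"
    using insert.prems by (intro insert.IH) auto
  then obtain c where c: "\<And>x. x \<in> S \<Longrightarrow> f j x = 0 \<Longrightarrow> \<phi> x = (\<Sum>i\<in>I. c i * f i x)"
    by auto
  show ?case
  proof (cases "\<forall>x\<in>S. f j x = 0")
    case True
    then show ?thesis
      using c insert.hyps by (intro exI[of _ c]) simp
  next
    case False
    then obtain s where s: "s \<in> S" "f j s \<noteq> 0" by auto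
    \<comment> \<open>The remainder \<open>\<psi>\<close> vanishes on the kernel of
      \<open>f j\<close> in \<open>S\<close>, so on \<open>S\<close> it is a multiple of
      \<open>f j\<close>; the factor is read off at \<open>s\<close>.\<close>
    define \<psi> where "\<psi> x = \<phi> x - (\<Sum>i\<in>I. c i * f i x)" for x
    have "linear \<psi>"
    proof (rule linearI)
      have lin: "linear (f i)" if "i \<in> I" for i using insert.prems that by simp
      note \<phi> = \<open>linear \<phi>\<close>
      show "\<psi> (x + y) = \<psi> x + \<psi> y" for x y
        by (simp add: \<psi>_def linear_add[OF \<phi>] linear_add[OF lin] sum.distrib algebra_simps
            cong: sum.cong)
      show "\<psi> (r *\<^sub>R x) = r *\<^sub>R \<psi> x" for r x
        by (simp add: \<psi>_def linear_scale[OF \<phi>] linear_scale[OF lin] sum_distrib_left algebra_simps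
            cong: sum.cong)
    qed
    have "\<psi> x = \<psi> s / f j s * f j x" if "x \<in> S" for x
    proof -
      \<comment> \<open>Subtracting a multiple of \<open>s\<close> moves \<open>x\<close> into the
        kernel of \<open>f j\<close>.\<close>
      define y where "y = x - (f j x / f j s) *\<^sub>R s"
      have "y \<in> S"
        unfolding y_def using insert.prems s that by (intro subspace_diff subspace_scale)
      moreover have "f j y = 0"
        using s by (simp add: y_def linear_diff[OF f] linear_scale[OF f])
      ultimately have "\<psi> y = 0"
        using c by (simp add: \<psi>_def)
      then show ?thesis
        by (simp add: y_def linear_diff[OF \<open>linear \<psi>\<close>] linear_scale[OF \<open>linear \<psi>\<close>])
    qed
    moreover have "\<phi> x = \<psi> x + (\<Sum>i\<in>I. c i * f i x)" for x
      by (simp add: \<psi>_def)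
    moreover have "(\<Sum>i\<in>I. (c(j := d)) i * f i x) = (\<Sum>i\<in>I. c i * f i x)" for d x
      using insert.hyps by (intro sum.cong) auto
    ultimately show ?thesis
      using insert.hyps by (intro exI[of _ "c(j := \<psi> s / f j s)"]) simp
  qed
qed

text \<open>A purely algebraic separation: \<open>l\<close> extends a basis of \<open>G\<close> to
  an independent set. No continuity of \<open>\<phi>\<close> is claimed.\<close>

lemma exists_linear_functional_separating:
  fixes G :: "'a::real_vector set"
  assumes G: "subspace G" and l: "l \<notin> G"
  obtains \<phi> :: "'a \<Rightarrow> real" where "linear \<phi>" "\<And>g. g \<in> G \<Longrightarrow> \<phi> g = 0" "\<phi> l = 1"
proof -
  obtain B where B: "B \<subseteq> G" "independent B" "G \<subseteq> span B"
    by (rule basis_exists)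
  have "span B = G"
    using B G by (simp add: span_subspace)
  then have "independent (insert l B)"
    using B l by (simp add: independent_insert)
  then obtain \<phi> :: "'a \<Rightarrow> real" where \<phi>: "linear \<phi>" "\<forall>x\<in>insert l B. \<phi> x = (if x = l then 1 else 0)"
    using linear_independent_extend[of "insert l B" "\<lambda>x. if x = l then 1 else 0 :: real"] by metis
  then have "\<phi> b = 0" if "b \<in> B" for b
    using that B(1) l by auto
  then have "\<phi> g = 0" if "g \<in> G" for g
    using linear_eq_0_on_span[OF \<phi>(1)] that B(3) by blast
  moreover have "\<phi> l = 1" using \<phi>(2) by simp
  ultimately show ?thesis using \<phi>(1) that by metis
qed

text \<open>Induction over the generation of the topology: a subbasic set tests one point, an
  intersection joins two finite sets of test points, and a union uses those of one member.\<close>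

lemma weak_star_open_contains_finite_agreement:
  assumes "openin weak_star_topology O'" "l \<in> O'"
  shows "\<exists>X. finite X \<and> (\<forall>m. (\<forall>x\<in>X. blinfun_apply m x = blinfun_apply l x) \<longrightarrow> m \<in> O')"
proof -
  have "generate_topology_on {(\<lambda>l. blinfun_apply l x) -` S | x S. open S} O'"
    using assms(1) unfolding weak_star_topology_def by (rule openin_topology_generated_by)
  then show ?thesis
    using assms(2)
  proof (induction rule: generate_topology_on.induct)
    case Empty
    then show ?case by simp
  next
    case (Int a b)
    from Int.IH(1) Int.prems obtain X where X: "finite X"
      "\<And>m. \<forall>x\<in>X. blinfun_apply m x = blinfun_apply l x \<Longrightarrow> m \<in> a"
      by (metis IntD1)
    from Int.IH(2) Int.prems obtain Y where Y: "finite Y"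
      "\<And>m. \<forall>x\<in>Y. blinfun_apply m x = blinfun_apply l x \<Longrightarrow> m \<in> b"
      by (metis IntD2)
    from X Y show ?case by (intro exI[of _ "X \<union> Y"]) simp
  next
    case (UN K)
    then obtain k where k: "k \<in> K" "l \<in> k" by auto
    from UN.IH[OF k] obtain X where X: "finite X"
      "\<And>m. \<forall>x\<in>X. blinfun_apply m x = blinfun_apply l x \<Longrightarrow> m \<in> k"
      by metis
    with k show ?case by (intro exI[of _ X]) auto
  next
    case (Basis s)
    then obtain x S where "s = (\<lambda>l. blinfun_apply l x) -` S"
      by blast
    with Basis.prems show ?case by (intro exI[of _ "{x}"]) simp
  qed
qed

section \<open>Annihilators\<close>

lemma subspace_annihilator: "subspace (annihilator V)"
  by (simp add: subspace_def annihilator_def blinfun.bilinear_simps)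

lemma subspace_preannihilator: "subspace (preannihilator F)"
  by (simp add: subspace_def preannihilator_def blinfun.bilinear_simps)

lemma closed_preannihilator: "closed (preannihilator F)"
proof -
  have "preannihilator F = (\<Inter>l\<in>F. {x. blinfun_apply l x = 0})"
    by (auto simp: preannihilator_def)
  moreover have "closed {x. blinfun_apply l x = 0}" for l :: "'a \<Rightarrow>\<^sub>L real"
    by (intro closed_Collect_eq continuous_intros)
  ultimately show ?thesis by auto
qed

lemma annihilator_preannihilator_superset: "F \<subseteq> annihilator (preannihilator F)"
  by (auto simp: annihilator_def preannihilator_def)

text \<open>The functional that attains the distance from \<open>x\<close> to \<open>W\<close> lies
  in the annihilator, so it kills \<open>x\<close>. The distance is then zero, and \<open>W\<close>
  is closed.\<close>

theorem preannihilator_annihilator: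
  assumes "subspace W" "closed W"
  shows "preannihilator (annihilator W) = W"
proof
  show "W \<subseteq> preannihilator (annihilator W)"
    by (auto simp: annihilator_def preannihilator_def)
  show "preannihilator (annihilator W) \<subseteq> W"
  proof
    fix x assume x: "x \<in> preannihilator (annihilator W)"
    obtain l where "l \<in> annihilator W" "blinfun_apply l x = infdist x W"
      using Hahn_Banach_subspace[OF assms(1)] by metis
    then have "infdist x W = 0"
      using x by (simp add: preannihilator_def)
    then show "x \<in> W"
      using assms subspace_0[OF assms(1)] in_closed_iff_infdist_zero by blast
  qed
qed

text \<open>For \<open>l\<close> outside \<open>G\<close>, some finite \<open>X\<close> is such that
  agreement with \<open>l\<close> on \<open>X\<close> keeps functionals out of \<open>G\<close>. A
  separating \<open>\<phi>\<close> is then a combination of evaluations at \<open>X\<close>, hence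
  evaluation at one point \<open>y\<close>, which \<open>G\<close> annihilates but \<open>l\<close>
  does not.\<close>

theorem annihilator_preannihilator:
  assumes G: "subspace G" and closed: "closedin weak_star_topology G"
  shows "annihilator (preannihilator G) = G"
proof (rule antisym[OF _ annihilator_preannihilator_superset], rule subsetI, rule ccontr)
  fix l assume l: "l \<in> annihilator (preannihilator G)" and "l \<notin> G"
  have "topspace weak_star_topology = (UNIV :: ('a \<Rightarrow>\<^sub>L real) set)"
    unfolding weak_star_topology_def topology_generated_by_topspace
    by (auto intro!: exI[of _ UNIV])
  then have "openin weak_star_topology (- G)"
    using closed by (simp add: closedin_def Compl_eq_Diff_UNIV)
  from weak_star_open_contains_finite_agreement[OF this, of l] obtain X where X: "finite X"
    "\<And>m. (\<And>x. x \<in> X \<Longrightarrow> blinfun_apply m x = blinfun_apply l x) \<Longrightarrow> m \<notin> G"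
    using \<open>l \<notin> G\<close> by auto
  obtain \<phi> :: "('a \<Rightarrow>\<^sub>L real) \<Rightarrow> real" where \<phi>: "linear \<phi>" "\<And>g. g \<in> G \<Longrightarrow> \<phi> g = 0" "\<phi> l = 1"
    using exists_linear_functional_separating[OF G \<open>l \<notin> G\<close>] by metis
  have "\<exists>c. \<forall>m\<in>span (insert l G). \<phi> m = (\<Sum>x\<in>X. c x * blinfun_apply m x)"
  proof (rule linear_functional_in_span[OF X(1) subspace_span \<phi>(1)])
    show "linear (\<lambda>m. blinfun_apply m x)" for x :: 'a
      by (intro linearI) (simp_all add: blinfun.bilinear_simps)
    fix m assume m: "m \<in> span (insert l G)" "\<And>x. x \<in> X \<Longrightarrow> blinfun_apply m x = 0"
    then obtain t where "m - t *\<^sub>R l \<in> span G"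
      by (auto simp: span_breakdown_eq)
    then have g: "m - t *\<^sub>R l \<in> G"
      using G by (simp add: span_eq_iff[THEN iffD2])
    \<comment> \<open>If \<open>t\<close> were nonzero, the displayed multiple would equal
      \<open>l - inverse t *\<^sub>R m\<close>. It agrees with \<open>l\<close> on \<open>X\<close>,
      where \<open>m\<close> vanishes, so it could not lie in \<open>G\<close>.\<close>
    have "t = 0"
    proof (rule ccontr)
      assume "t \<noteq> 0"
      then have "(- inverse t) *\<^sub>R (m - t *\<^sub>R l) \<notin> G"
        using m(2) by (intro X(2)) (simp add: blinfun.bilinear_simps)
      then show False using subspace_scale[OF G g] by blast
    qed
    then show "\<phi> m = 0" using g \<phi>(2) by simp
  qed
  then obtain c where c: "\<And>m. m \<in> insert l G \<Longrightarrow> \<phi> m = (\<Sum>x\<in>X. c x * blinfun_apply m x)"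
    using span_base by metis
  define y where "y = (\<Sum>x\<in>X. c x *\<^sub>R x)"
  have y: "blinfun_apply m y = \<phi> m" if "m \<in> insert l G" for m
    using c[OF that] by (simp add: y_def blinfun.bilinear_simps)
  then have "y \<in> preannihilator G"
    using \<phi>(2) by (simp add: preannihilator_def)
  then show False
    using l y[of l] \<phi>(3) by (simp add: annihilator_def)
qed

lemma norming_functional:
  fixes x :: "'a::real_normed_vector"
  obtains l :: "'a \<Rightarrow>\<^sub>L real" where "norm l \<le> 1" "blinfun_apply l x = norm x"
proof -
  obtain l :: "'a \<Rightarrow>\<^sub>L real" where "norm l \<le> 1" "blinfun_apply l x = infdist x {0}"
    using Hahn_Banach_subspace[OF subspace_single_0] by metis
  then show ?thesis by (intro that) simp_all
qed

section \<open>Complements of finite-dimensional subspaces\<close>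

text \<open>With a functional \<open>l\<close> vanishing on \<open>W\<close> and nonzero at
  \<open>x\<close>, the coordinate of \<open>z\<close> along \<open>x\<close> is the continuous
  expression \<open>blinfun_apply l z / d\<close>. The span is thus a preimage of \<open>W\<close>
  under a continuous map.\<close>

lemma closed_subspace_plus_line:
  fixes W :: "'a::real_normed_vector set"
  assumes W: "subspace W" "closed W"
  shows "closed (span (insert x W))"
proof (cases "x \<in> W")
  case True
  then show ?thesis
    using W by (simp add: insert_absorb span_eq_iff[THEN iffD2])
next
  case False
  obtain l where l: "l \<in> annihilator W" "blinfun_apply l x = infdist x W"
    using Hahn_Banach_subspace[OF W(1)] by metis
  define d where "d = infdist x W"
  have d: "d \<noteq> 0"
    using False W subspace_0[OF W(1)] in_closed_iff_infdist_zero unfolding d_def by blast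
  have "span (insert x W) = {z. z - (blinfun_apply l z / d) *\<^sub>R x \<in> W}" (is "_ = ?R")
  proof (intro set_eqI iffI)
    fix z assume "z \<in> span (insert x W)"
    then obtain t where "z - t *\<^sub>R x \<in> span W"
      by (auto simp: span_breakdown_eq)
    then have t: "z - t *\<^sub>R x \<in> W"
      using W(1) by (simp add: span_eq_iff[THEN iffD2])
    then have "blinfun_apply l (z - t *\<^sub>R x) = 0"
      using l(1) by (simp add: annihilator_def)
    then have "t = blinfun_apply l z / d"
      using d l(2) by (simp add: blinfun.bilinear_simps d_def)
    with t show "z \<in> ?R" by simp
  next
    fix z assume "z \<in> ?R"
    then show "z \<in> span (insert x W)"
      unfolding span_breakdown_eq by (auto intro: span_base)
  qed
  also have "\<dots> = (\<lambda>z. z - (blinfun_apply l z / d) *\<^sub>R x) -` W"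
    by auto
  also have "closed \<dots>"
    by (intro closed_vimage W continuous_intros ballI d)
  finally show ?thesis .
qed

lemma closed_span_Un_finite:
  fixes W :: "'a::real_normed_vector set"
  assumes "finite B" "subspace W" "closed W"
  shows "closed (span (B \<union> W))"
  using assms(1)
proof (induction rule: finite_induct)
  case empty
  then show ?case using assms by (simp add: span_eq_iff[THEN iffD2])
next
  case (insert b B)
  have "span (insert b B \<union> W) = span (insert b (span (B \<union> W)))"
    by (simp add: span_insert span_span)
  then show ?case
    using closed_subspace_plus_line[OF subspace_span insert.IH] by simp
qed

lemma finite_dimensional_basis:
  assumes "subspace V" "finite_dimensional V"
  obtains B where "finite B" "independent B" "span B = V"
proof -
  obtain C where C: "finite C" "span C = V"
    using assms(2) by (auto simp: finite_dimensional_def)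
  obtain B where B: "B \<subseteq> V" "independent B" "V \<subseteq> span B"
    by (rule basis_exists)
  moreover have "finite B"
    using independent_span_bound[OF C(1) B(2)] B(1) C(2) by simp
  moreover have "span B = V"
    using B assms(1) by (simp add: span_subspace)
  ultimately show ?thesis using that by blast
qed

section \<open>Algebraic direct sums, their projections, and biorthogonal functionals\<close>

lemma direct_sum_decompose:
  assumes "is_direct_sum A B"
  obtains a b where "a \<in> A" "b \<in> B" "x = a + b"
proof -
  have "x \<in> {a + b | a b. a \<in> A \<and> b \<in> B}"
    using assms by (simp add: is_direct_sum_def)
  then show ?thesis using that by blast
qed

lemma direct_sum_disjoint: "is_direct_sum A B \<Longrightarrow> x \<in> A \<Longrightarrow> x \<in> B \<Longrightarrow> x = 0"
  by (auto simp: is_direct_sum_def)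

lemma is_direct_sumI:
  assumes "\<And>x. \<exists>a\<in>A. \<exists>b\<in>B. x = a + b" "\<And>x. x \<in> A \<Longrightarrow> x \<in> B \<Longrightarrow> x = 0" "0 \<in> A" "0 \<in> B"
  shows "is_direct_sum A B"
  unfolding is_direct_sum_def
proof
  show "{a + b |a b. a \<in> A \<and> b \<in> B} = UNIV"
    using assms(1) by blast
  show "A \<inter> B = {0}"
    using assms(2-4) by blast
qed

lemma is_direct_sum_commute:
  assumes "is_direct_sum A B"
  shows "is_direct_sum B A"
proof (rule is_direct_sumI)
  fix x
  obtain a b where "a \<in> A" "b \<in> B" "x = a + b"
    using direct_sum_decompose[OF assms] .
  then show "\<exists>b\<in>B. \<exists>a\<in>A. x = b + a"
    using add.commute by blast
qed (use assms in \<open>auto simp: is_direct_sum_def\<close>)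

text \<open>The description in \<open>projection_along\<close> is unique because the difference of
  two candidates lies in both summands.\<close>

lemma projection_along_eq:
  assumes "subspace A" "subspace B" "is_direct_sum A B" "a \<in> A" "b \<in> B"
  shows "projection_along A B (a + b) = a"
  unfolding projection_along_def
proof (rule the_equality)
  fix c assume c: "c \<in> A \<and> (\<exists>b'\<in>B. a + b = c + b')"
  then obtain b' where b': "b' \<in> B" "a + b = c + b'" by auto
  then have "a - c = b' - b" by (simp add: algebra_simps)
  moreover have "a - c \<in> A" "b' - b \<in> B"
    using assms c b' by (auto intro: subspace_diff)
  ultimately have "a - c = 0"
    using direct_sum_disjoint[OF assms(3)] by metis
  then show "c = a" by simp
qed (use assms in auto)

text \<open>For each basis vector \<open>b\<close>, separate \<open>b\<close> from the closed subspace spanned by \<open>U\<close> and the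
  remaining basis vectors.\<close>

lemma exists_dual_basis:
  fixes B U :: "'a::real_normed_vector set"
  assumes B: "finite B" "independent B" and U: "subspace U" "closed U"
    and disj: "span B \<inter> U = {0}"
  obtains f where "\<And>b. b \<in> B \<Longrightarrow> f b \<in> annihilator U"
    "\<And>b c. b \<in> B \<Longrightarrow> c \<in> B \<Longrightarrow> blinfun_apply (f b) c = (if b = c then 1 else 0)"
proof -
  have "\<exists>l\<in>annihilator U. \<forall>c\<in>B. blinfun_apply l c = (if b = c then 1 else 0)" if b: "b \<in> B" for b
  proof -
    define W where "W = span ((B - {b}) \<union> U)"
    have W: "subspace W" "closed W"
      unfolding W_def using closed_span_Un_finite[OF _ U, of "B - {b}"] B by auto
    have "b \<notin> W"
    proof
      assume "b \<in> W"
      then obtain v u where vu: "v \<in> span (B - {b})" "u \<in> U" "b = v + u"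
        using U(1) unfolding W_def span_Un by (auto simp: span_eq_iff[THEN iffD2])
      \<comment> \<open>As \<open>u = b - v\<close> lies in \<open>span B\<close> and in
        \<open>U\<close>, it is zero; then \<open>b = v\<close> contradicts independence.\<close>
      have "u \<in> span B"
        using vu span_base[OF b] span_mono[of "B - {b}" B] by (metis Diff_subset add_diff_cancel_left' span_diff subsetD)
      then have "u = 0" using vu disj by auto
      then show False
        using B(2) b vu by (auto simp: dependent_def)
    qed
    obtain l where l: "l \<in> annihilator W" "blinfun_apply l b = infdist b W"
      using Hahn_Banach_subspace[OF W(1)] by metis
    have d: "infdist b W \<noteq> 0"
      using \<open>b \<notin> W\<close> W subspace_0[OF W(1)] in_closed_iff_infdist_zero by blast
    have zero: "blinfun_apply l c = 0" if "c \<in> (B - {b}) \<union> U" for c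
      using l(1) that span_base[OF that] unfolding W_def annihilator_def by blast
    \<comment> \<open>Dividing by the nonzero distance normalises the value at \<open>b\<close> to
      1.\<close>
    show ?thesis
    proof (intro bexI[of _ "inverse (infdist b W) *\<^sub>R l"] ballI)
      show "inverse (infdist b W) *\<^sub>R l \<in> annihilator U"
        using zero by (simp add: annihilator_def blinfun.bilinear_simps)
      show "blinfun_apply (inverse (infdist b W) *\<^sub>R l) c = (if b = c then 1 else 0)" if "c \<in> B" for c
        using zero[of c] l(2) d that by (auto simp: blinfun.bilinear_simps)
    qed
  qed
  then show ?thesis using that by metis
qed

text \<open>This setting is instantiated twice: with the given \<open>V\<close> and
  \<open>U\<close>, and with the pre-annihilators of \<open>G\<close> and \<open>F\<close> in the
  roles of \<open>V\<close> and \<open>U\<close>.\<close>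

locale finite_dimensional_complement =
  fixes V U :: "'a::real_normed_vector set"
  assumes subspace_V: "subspace V" and subspace_U: "subspace U" and closed_U: "closed U"
    and finite_dimensional_V: "finite_dimensional V" and direct_sum: "is_direct_sum V U"
begin

lemma dual_basis:
  obtains B f where "finite B" "independent B" "span B = V"
    "\<And>b. b \<in> B \<Longrightarrow> f b \<in> annihilator U"
    "\<And>b c. b \<in> B \<Longrightarrow> c \<in> B \<Longrightarrow> blinfun_apply (f b) c = (if b = c then 1 else 0)"
proof -
  obtain B where B: "finite B" "independent B" "span B = V"
    using finite_dimensional_basis[OF subspace_V finite_dimensional_V] .
  then have "span B \<inter> U = {0}"
    using direct_sum by (simp add: is_direct_sum_def)
  from exists_dual_basis[OF B(1,2) subspace_U closed_U this] B that show ?thesis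
    by metis
qed

text \<open>The biorthogonal system gives the projection as a finite sum of bounded rank-one
  operators, hence as a bounded operator.\<close>

lemma blinfun_projection:
  obtains P :: "'a \<Rightarrow>\<^sub>L 'a" where "\<And>v. v \<in> V \<Longrightarrow> blinfun_apply P v = v"
    "\<And>u. u \<in> U \<Longrightarrow> blinfun_apply P u = 0"
proof -
  obtain B f where B: "finite B" "independent B" "span B = V"
    and fU: "\<And>b. b \<in> B \<Longrightarrow> f b \<in> annihilator U"
    and fB: "\<And>b c. b \<in> B \<Longrightarrow> c \<in> B \<Longrightarrow> blinfun_apply (f b) c = (if b = c then 1 else 0)"
    using dual_basis by metis
  define P where "P = Blinfun (\<lambda>x. \<Sum>b\<in>B. blinfun_apply (f b) x *\<^sub>R b)"
  have P: "blinfun_apply P x = (\<Sum>b\<in>B. blinfun_apply (f b) x *\<^sub>R b)" for x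
    unfolding P_def
    by (subst bounded_linear_Blinfun_apply)
      (auto intro!: bounded_linear_sum bounded_linear_scaleR_const blinfun.bounded_linear_right)
  have "blinfun_apply P c = c" if "c \<in> B" for c
  proof -
    have "blinfun_apply P c = (\<Sum>b\<in>B. if b = c then c else 0)"
      unfolding P using that by (intro sum.cong) (auto simp: fB)
    also have "\<dots> = c" using that B(1) by simp
    finally show ?thesis .
  qed
  then have "blinfun_apply P v = v" if "v \<in> V" for v
    using linear_eq_on[of "blinfun_apply P" "\<lambda>x. x" v B] that B(3)
    by (simp add: blinfun.bounded_linear_right bounded_linear.linear linear_ident)
  moreover have "blinfun_apply P u = 0" if "u \<in> U" for u
    using fU that by (simp add: P annihilator_def)
  ultimately show ?thesis using that by metis
qed

text \<open>Composition with the projection \<open>P\<close> splits \<open>l\<close>: the part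
  \<open>l o\<^sub>L P\<close> vanishes on \<open>U\<close>, and the rest vanishes on
  \<open>V\<close>. A functional vanishing on both summands is zero.\<close>

lemma is_direct_sum_annihilator: "is_direct_sum (annihilator V) (annihilator U)"
proof (rule is_direct_sumI)
  fix l :: "'a \<Rightarrow>\<^sub>L real"
  obtain P where P: "\<And>v. v \<in> V \<Longrightarrow> blinfun_apply P v = v" "\<And>u. u \<in> U \<Longrightarrow> blinfun_apply P u = 0"
    using blinfun_projection by metis
  show "\<exists>a\<in>annihilator V. \<exists>b\<in>annihilator U. l = a + b"
  proof (intro bexI)
    show "l = (l - (l o\<^sub>L P)) + (l o\<^sub>L P)" by simp
  qed (use P in \<open>simp_all add: annihilator_def blinfun.bilinear_simps\<close>)
next
  fix l :: "'a \<Rightarrow>\<^sub>L real"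
  assume "l \<in> annihilator V" "l \<in> annihilator U"
  moreover have "\<exists>v\<in>V. \<exists>u\<in>U. x = v + u" for x
    using direct_sum_decompose[OF direct_sum, of x] by metis
  ultimately have "blinfun_apply l x = 0" for x
    unfolding annihilator_def by (metis (mono_tags, lifting) mem_Collect_eq blinfun.add_right add_0)
  then show "l = 0" by (intro blinfun_eqI) simp
qed (simp_all add: subspace_0 subspace_annihilator)

text \<open>The dual basis \<open>f\<close> is a basis of the annihilator of \<open>U\<close>, with
  coordinates read off by evaluation on \<open>B\<close>.\<close>

lemma annihilator_complement:
  "finite_dimensional (annihilator U) \<and> dim (annihilator U) = dim V"
proof -
  obtain B f where B: "finite B" "independent B" "span B = V"
    and fU: "\<And>b. b \<in> B \<Longrightarrow> f b \<in> annihilator U"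
    and fB: "\<And>b c. b \<in> B \<Longrightarrow> c \<in> B \<Longrightarrow> blinfun_apply (f b) c = (if b = c then 1 else 0)"
    using dual_basis by metis
  have apply_sum: "blinfun_apply (\<Sum>b\<in>B. c b *\<^sub>R f b) a = c a" if "a \<in> B" for c a
  proof -
    have "blinfun_apply (\<Sum>b\<in>B. c b *\<^sub>R f b) a = (\<Sum>b\<in>B. if b = a then c b else 0)"
      using that by (auto simp: blinfun.bilinear_simps fB intro!: sum.cong)
    also have "\<dots> = c a" using that B(1) by simp
    finally show ?thesis .
  qed
  have inj: "inj_on f B"
    using fB by (intro inj_onI) (metis zero_neq_one)
  have "independent (f ` B)"
  proof (rule independent_if_scalars_zero)
    fix c l assume "(\<Sum>l\<in>f ` B. c l *\<^sub>R l) = 0" and "l \<in> f ` B"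
    then obtain a where a: "a \<in> B" "l = f a" and "(\<Sum>b\<in>B. c (f b) *\<^sub>R f b) = 0"
      by (auto simp: sum.reindex[OF inj])
    then show "c l = 0" using apply_sum[OF a(1), of "\<lambda>b. c (f b)"] by simp
  qed (use B in simp)
  moreover have "span (f ` B) = annihilator U"
  proof
    show "span (f ` B) \<subseteq> annihilator U"
      using fU by (intro span_minimal subspace_annihilator) auto
    show "annihilator U \<subseteq> span (f ` B)"
    proof
      fix l assume l: "l \<in> annihilator U"
      define m where "m = (\<Sum>b\<in>B. blinfun_apply l b *\<^sub>R f b)"
      have m: "m \<in> span (f ` B)"
        unfolding m_def by (intro span_sum span_scale span_base) simp
      then have "l - m \<in> annihilator U"
        using l \<open>span (f ` B) \<subseteq> annihilator U\<close> by (intro subspace_diff subspace_annihilator) auto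
      \<comment> \<open>The combination \<open>m\<close> has the same values on \<open>B\<close> as
        \<open>l\<close>, so the difference vanishes on \<open>V\<close> as well as on
        \<open>U\<close>.\<close>
      moreover have "l - m \<in> annihilator V"
      proof -
        have "blinfun_apply (l - m) b = 0" if "b \<in> B" for b
          using apply_sum[OF that] by (simp add: m_def blinfun.diff_left)
        then have "blinfun_apply (l - m) v = 0" if "v \<in> V" for v
          using linear_eq_0_on_span[of "blinfun_apply (l - m)" B v] that B(3)
          by (simp add: blinfun.bounded_linear_right bounded_linear.linear)
        then show ?thesis by (simp add: annihilator_def)
      qed
      ultimately have "l - m = 0"
        using direct_sum_disjoint[OF is_direct_sum_annihilator] by blast
      with m show "l \<in> span (f ` B)" by simp
    qed
  qed
  ultimately show ?thesis
    using B inj unfolding finite_dimensional_def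
    by (metis dim_span_eq_card_independent card_image finite_imageI)
qed

lemma projection_along_blinfun:
  assumes "\<And>v. v \<in> V \<Longrightarrow> blinfun_apply P v = v" "\<And>u. u \<in> U \<Longrightarrow> blinfun_apply P u = 0"
  shows "projection_along V U = blinfun_apply P"
    and "projection_along (annihilator U) (annihilator V) = (\<lambda>l. l o\<^sub>L P)"
proof -
  show "projection_along V U = blinfun_apply P"
  proof
    fix x
    obtain v u where "v \<in> V" "u \<in> U" "x = v + u"
      using direct_sum_decompose[OF direct_sum] .
    then show "projection_along V U x = blinfun_apply P x"
      using projection_along_eq[OF subspace_V subspace_U direct_sum] assms
      by (simp add: blinfun.bilinear_simps)
  qed
  have "projection_along (annihilator U) (annihilator V) ((l o\<^sub>L P) + (l - (l o\<^sub>L P))) = l o\<^sub>L P" for l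
    using assms
    by (intro projection_along_eq subspace_annihilator is_direct_sum_commute[OF is_direct_sum_annihilator])
      (simp_all add: annihilator_def blinfun.bilinear_simps)
  moreover have "(l o\<^sub>L P) + (l - (l o\<^sub>L P)) = l" for l :: "'a \<Rightarrow>\<^sub>L real"
    by simp
  ultimately show "projection_along (annihilator U) (annihilator V) = (\<lambda>l. l o\<^sub>L P)"
    by (intro ext) metis
qed

text \<open>The dual projection is the adjoint of \<open>P\<close>, and an operator and its adjoint
  have equal norms. One inequality is submultiplicativity; the other tests the adjoint on a norming
  functional of \<open>blinfun_apply P x\<close>. Boundedness is stated too, since it is what makes
  \<open>onorm\<close> the genuine operator norm.\<close>

lemma projection_along_bounded_onorm:
  "bounded_linear (projection_along V U) \<and>
   bounded_linear (projection_along (annihilator U) (annihilator V)) \<and>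
   onorm (projection_along V U) = onorm (projection_along (annihilator U) (annihilator V))"
proof -
  obtain P where P: "\<And>v. v \<in> V \<Longrightarrow> blinfun_apply P v = v" "\<And>u. u \<in> U \<Longrightarrow> blinfun_apply P u = 0"
    using blinfun_projection by metis
  have bl: "bounded_linear (\<lambda>l :: 'a \<Rightarrow>\<^sub>L real. l o\<^sub>L P)"
    by (rule bounded_bilinear.bounded_linear_left[OF bounded_bilinear_blinfun_compose])
  have "onorm (\<lambda>l :: 'a \<Rightarrow>\<^sub>L real. l o\<^sub>L P) \<le> norm P"
    by (intro onorm_bound) (simp_all add: norm_blinfun_compose mult.commute[of "norm P"])
  moreover have "norm P \<le> onorm (\<lambda>l :: 'a \<Rightarrow>\<^sub>L real. l o\<^sub>L P)"
  proof (rule norm_blinfun_bound)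
    fix x
    obtain l where l: "norm l \<le> 1" "blinfun_apply l (blinfun_apply P x) = norm (blinfun_apply P x)"
      using norming_functional by metis
    have "norm (blinfun_apply P x) \<le> norm (l o\<^sub>L P) * norm x"
      using norm_blinfun[of "l o\<^sub>L P" x] l(2) by simp
    also have "norm (l o\<^sub>L P) \<le> onorm (\<lambda>l :: 'a \<Rightarrow>\<^sub>L real. l o\<^sub>L P) * norm l"
      by (rule onorm[OF bl])
    also have "\<dots> \<le> onorm (\<lambda>l :: 'a \<Rightarrow>\<^sub>L real. l o\<^sub>L P)"
      using l(1) onorm_pos_le[OF bl] by (simp add: mult_left_le)
    finally show "norm (blinfun_apply P x) \<le> onorm (\<lambda>l :: 'a \<Rightarrow>\<^sub>L real. l o\<^sub>L P) * norm x"
      by (simp add: mult_right_mono)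
  qed (rule onorm_pos_le[OF bl])
  ultimately have "norm P = onorm (\<lambda>l :: 'a \<Rightarrow>\<^sub>L real. l o\<^sub>L P)" by simp
  then show ?thesis
    by (simp add: projection_along_blinfun[OF P] bl blinfun.bounded_linear_right norm_blinfun.rep_eq)
qed

end

section \<open>Pre-annihilators of a decomposition of the dual\<close>

text \<open>Vectors \<open>\<xi> b\<close> in the pre-annihilator of \<open>G\<close>, biorthogonal
  to a basis of \<open>F\<close>, give the decomposition and also span that pre-annihilator.\<close>

theorem preannihilator_direct_sum:
  fixes F G :: "('a::real_normed_vector \<Rightarrow>\<^sub>L real) set"
  assumes F: "subspace F" "finite_dimensional F"
    and G: "subspace G" "closedin weak_star_topology G"
    and FG: "is_direct_sum F G"
  shows "is_direct_sum (preannihilator F) (preannihilator G)"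
    and "finite_dimensional (preannihilator G)"
    and "annihilator (preannihilator F) = F"
proof -
  obtain B where B: "finite B" "independent B" "span B = F"
    using finite_dimensional_basis[OF F] .
  have "\<exists>x\<in>preannihilator G. \<forall>c\<in>B. blinfun_apply c x = (if b = c then 1 else 0)" if b: "b \<in> B" for b
  proof -
    \<comment> \<open>Otherwise \<open>b\<close> would agree on the pre-annihilator of
      \<open>G\<close> with a combination \<open>m\<close> of the other basis elements. Then
      \<open>b - m\<close> would lie in \<open>G\<close>, as \<open>G\<close> is weak-star closed,
      and in \<open>F\<close>, so \<open>b = m\<close>, against independence.\<close>
    have "\<exists>x\<in>preannihilator G. (\<forall>c\<in>B - {b}. blinfun_apply c x = 0) \<and> blinfun_apply b x \<noteq> 0"
    proof (rule ccontr)
      assume "\<not> ?thesis"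
      then have "\<exists>a. \<forall>x\<in>preannihilator G. blinfun_apply b x = (\<Sum>c\<in>B - {b}. a c * blinfun_apply c x)"
        using B(1) by (intro linear_functional_in_span subspace_preannihilator)
          (auto simp: blinfun.bounded_linear_right bounded_linear.linear)
      then obtain a where a: "\<And>x. x \<in> preannihilator G \<Longrightarrow> blinfun_apply b x = (\<Sum>c\<in>B - {b}. a c * blinfun_apply c x)"
        by auto
      define m where "m = (\<Sum>c\<in>B - {b}. a c *\<^sub>R c)"
      have m: "m \<in> span (B - {b})"
        unfolding m_def by (intro span_sum span_scale span_base)
      have "b - m \<in> annihilator (preannihilator G)"
        using a by (simp add: annihilator_def m_def blinfun.bilinear_simps)
      then have "b - m \<in> G" by (simp add: annihilator_preannihilator[OF G])
      moreover have "b - m \<in> F"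
        using m b B(3) span_mono[of "B - {b}" B] by (auto intro: span_diff span_base)
      ultimately have "b = m"
        using direct_sum_disjoint[OF FG] by fastforce
      with m show False
        using B(2) b by (auto simp: dependent_def)
    qed
    then obtain x where x: "x \<in> preannihilator G" "\<forall>c\<in>B - {b}. blinfun_apply c x = 0" "blinfun_apply b x \<noteq> 0"
      by auto
    then show ?thesis
      by (intro bexI[of _ "inverse (blinfun_apply b x) *\<^sub>R x"])
        (auto simp: blinfun.bilinear_simps intro!: subspace_scale subspace_preannihilator)
  qed
  then obtain \<xi> where \<xi>: "\<And>b. b \<in> B \<Longrightarrow> \<xi> b \<in> preannihilator G"
    and dual: "\<And>b c. b \<in> B \<Longrightarrow> c \<in> B \<Longrightarrow> blinfun_apply c (\<xi> b) = (if b = c then 1 else 0)"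
    by metis
  \<comment> \<open>This \<open>Q\<close> is the projection onto the pre-annihilator of
    \<open>G\<close> along that of \<open>F\<close>.\<close>
  define Q where "Q x = (\<Sum>b\<in>B. blinfun_apply b x *\<^sub>R \<xi> b)" for x
  have Q_span: "Q x \<in> span (\<xi> ` B)" for x
    unfolding Q_def by (intro span_sum span_scale span_base) simp
  have span_sub: "span (\<xi> ` B) \<subseteq> preannihilator G"
    using \<xi> by (intro span_minimal subspace_preannihilator) auto
  have Q_F: "x - Q x \<in> preannihilator F" for x
  proof -
    have "blinfun_apply c (Q x) = blinfun_apply c x" if c: "c \<in> B" for c
    proof -
      have "blinfun_apply c (Q x) = (\<Sum>b\<in>B. if b = c then blinfun_apply b x else 0)"
        unfolding Q_def using c by (auto simp: blinfun.bilinear_simps dual intro!: sum.cong)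
      also have "\<dots> = blinfun_apply c x" using c B(1) by simp
      finally show ?thesis .
    qed
    then have "blinfun_apply l (x - Q x) = 0" if "l \<in> F" for l
      using linear_eq_0_on_span[OF bounded_linear.linear[OF blinfun.bounded_linear_left], of B "x - Q x" l]
        that B(3)
      by (simp add: blinfun.diff_right)
    then show ?thesis by (simp add: preannihilator_def)
  qed
  have disj: "x = 0" if x: "x \<in> preannihilator F" "x \<in> preannihilator G" for x
  proof -
    \<comment> \<open>A norming functional of \<open>x\<close> splits into parts in \<open>F\<close>
      and \<open>G\<close>, both of which kill \<open>x\<close>.\<close>
    obtain l :: "'a \<Rightarrow>\<^sub>L real" where l: "blinfun_apply l x = norm x"
      using norming_functional by metis
    obtain f g where "f \<in> F" "g \<in> G" "l = f + g"
      using direct_sum_decompose[OF FG] .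
    then have "blinfun_apply l x = 0"
      using x by (simp add: preannihilator_def blinfun.bilinear_simps)
    with l show ?thesis by simp
  qed
  show ds: "is_direct_sum (preannihilator F) (preannihilator G)"
  proof (rule is_direct_sumI)
    fix x
    show "\<exists>a\<in>preannihilator F. \<exists>b\<in>preannihilator G. x = a + b"
      using Q_F[of x] Q_span[of x] span_sub by (intro bexI[of _ "x - Q x"] bexI[of _ "Q x"]) auto
  qed (simp_all add: disj subspace_0 subspace_preannihilator)
  have "span (\<xi> ` B) = preannihilator G"
  proof (rule antisym[OF span_sub], rule subsetI)
    fix x assume "x \<in> preannihilator G"
    moreover have "Q x \<in> preannihilator G" using Q_span span_sub by blast
    ultimately have "x - Q x = 0"
      using Q_F by (intro disj) (auto intro: subspace_diff subspace_preannihilator)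
    then show "x \<in> span (\<xi> ` B)" using Q_span[of x] by simp
  qed
  then show "finite_dimensional (preannihilator G)"
    unfolding finite_dimensional_def using B(1) by blast
  show "annihilator (preannihilator F) = F"
  proof (rule antisym[OF _ annihilator_preannihilator_superset], rule subsetI)
    fix l assume l: "l \<in> annihilator (preannihilator F)"
    obtain f g where fg: "f \<in> F" "g \<in> G" "l = f + g"
      using direct_sum_decompose[OF FG] .
    \<comment> \<open>On the pre-annihilator of \<open>F\<close> both \<open>l\<close> and
      \<open>f\<close> vanish, hence so does \<open>g\<close>; on that of \<open>G\<close> it
      vanishes because \<open>g\<close> lies in \<open>G\<close>.\<close>
    have "blinfun_apply g x = 0" for x
    proof -
      obtain y z where "y \<in> preannihilator F" "z \<in> preannihilator G" "x = y + z"
        using direct_sum_decompose[OF ds] .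
      moreover from this have "blinfun_apply l y = 0" "blinfun_apply f y = 0" "blinfun_apply g z = 0"
        using l fg by (auto simp: annihilator_def preannihilator_def)
      ultimately show ?thesis
        using fg(3) by (simp add: blinfun.bilinear_simps)
    qed
    then have "g = 0" by (intro blinfun_eqI) simp
    with fg show "l \<in> F" by simp
  qed
qed

theorem lemma1p2:
  shows
    "(\<forall>V U :: 'a::banach set.
        subspace V \<and> closed V \<and> subspace U \<and> closed U \<and>
        finite_dimensional V \<and> is_direct_sum V U \<longrightarrow>
          is_direct_sum (annihilator V) (annihilator U) \<and>
          finite_dimensional (annihilator U) \<and> dim (annihilator U) = dim V \<and>
          preannihilator (annihilator V) = V \<and>
          preannihilator (annihilator U) = U) \<and>
     (\<forall>F G :: ('a \<Rightarrow>\<^sub>L real) set.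
        subspace F \<and> closedin weak_star_topology F \<and>
        subspace G \<and> closedin weak_star_topology G \<and>
        finite_dimensional F \<and> is_direct_sum F G \<longrightarrow>
          is_direct_sum (preannihilator F) (preannihilator G) \<and>
          finite_dimensional (preannihilator G) \<and> dim (preannihilator G) = dim F \<and>
          annihilator (preannihilator F) = F \<and>
          annihilator (preannihilator G) = G) \<and>
     (\<forall>V U :: 'a set.
        subspace V \<and> closed V \<and> subspace U \<and> closed U \<and>
        finite_dimensional V \<and> is_direct_sum V U \<longrightarrow>
          bounded_linear (projection_along V U) \<and>
          bounded_linear (projection_along (annihilator U) (annihilator V)) \<and>
          onorm (projection_along V U) =
            onorm (projection_along (annihilator U) (annihilator V)))"
proof (intro conjI allI impI; elim conjE)
  fix V U :: "'a set"
  assume VU: "subspace V" "closed V" "subspace U" "closed U" "finite_dimensional V"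
    "is_direct_sum V U"
  interpret finite_dimensional_complement V U
    using VU by unfold_locales
  show "is_direct_sum (annihilator V) (annihilator U)"
    by (rule is_direct_sum_annihilator)
  show "finite_dimensional (annihilator U)" "dim (annihilator U) = dim V"
    using annihilator_complement by blast+
  show "preannihilator (annihilator V) = V" "preannihilator (annihilator U) = U"
    using VU by (simp_all add: preannihilator_annihilator)
  show "bounded_linear (projection_along V U)"
    "bounded_linear (projection_along (annihilator U) (annihilator V))"
    "onorm (projection_along V U) = onorm (projection_along (annihilator U) (annihilator V))"
    using projection_along_bounded_onorm by blast+
next
  fix F G :: "('a \<Rightarrow>\<^sub>L real) set"
  assume F: "subspace F" "finite_dimensional F"
    and G: "subspace G" "closedin weak_star_topology G" and FG: "is_direct_sum F G"
  note pre = preannihilator_direct_sum[OF F G FG]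
  show "is_direct_sum (preannihilator F) (preannihilator G)"
    "finite_dimensional (preannihilator G)" "annihilator (preannihilator F) = F"
    by (fact pre)+
  \<comment> \<open>The order is swapped because the pre-annihilator of \<open>G\<close> is the
    finite-dimensional summand. The annihilator of its complement is \<open>F\<close> by
    \<open>pre(3)\<close>, so the dimension formula already proved applies.\<close>
  interpret finite_dimensional_complement "preannihilator G" "preannihilator F"
    using pre by unfold_locales
      (auto intro: subspace_preannihilator closed_preannihilator is_direct_sum_commute)
  show "dim (preannihilator G) = dim F"
    using annihilator_complement pre(3) by simp
  show "annihilator (preannihilator G) = G"
    by (rule annihilator_preannihilator[OF G])
qed

end
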